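(* For all co-prime integers $a$ and $b$ with $1<a<b$, the set $\mathcal{F}_{(a,b)}$ is dense in $[1,a]_{\mathbb{R}}=\{x\in\mathbb{R}:1\le x\le a\}$.
   Context: $\mathbb{N}=\{0,1,2,\dots\}$. For co-prime integers $1<a<b$, $\mathcal{F}_{(a,b)}$ is the set of rational numbers $a^q/b^p$, where $p\in\mathbb{N}$ and $q=\lceil p\log b/\log a\rceil$ is the smallest nonnegative integer with $1\le a^q/b^p$ (so $1\le a^q/b^p<a$). The segment $[1,a]_{\mathbb{R}}$ carries the usual topology of $\mathbb{R}$. *)

theory Defs
  imports "HOL-Analysis.Analysis"
begin

definition F_set :: "int \<Rightarrow> int \<Rightarrow> rat set" where
  "F_set a b =
     {of_int a ^ q / of_int b ^ p | p q :: nat.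
        int q = \<lceil>real p * ln (real_of_int b) / ln (real_of_int a)\<rceil>}"

text \<open>
  The ceiling is the least exponent \<open>q\<close> for which the fraction is at least 1, and all
  fractions of \<open>F_set a b\<close> lie in \<open>[1, a)\<close>.
\<close>

lemma one_le_power_quotient_iff:
  fixes a b :: int and p q :: nat
  assumes "1 < a" "a < b"
  shows "1 \<le> (of_int a ^ q / of_int b ^ p :: rat) \<longleftrightarrow>
           \<lceil>real p * ln (real_of_int b) / ln (real_of_int a)\<rceil> \<le> int q"
proof -
  have "1 \<le> (of_int a ^ q / of_int b ^ p :: rat) \<longleftrightarrow> b ^ p \<le> a ^ q"
    using assms by (simp add: le_divide_eq flip: of_int_power)
  also have "\<dots> \<longleftrightarrow> real_of_int b ^ p \<le> real_of_int a ^ q"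
    by (simp flip: of_int_power)
  also have "\<dots> \<longleftrightarrow> ln (real_of_int b ^ p) \<le> ln (real_of_int a ^ q)"
    using assms by (subst ln_le_cancel_iff) auto
  also have "\<dots> \<longleftrightarrow> real p * ln (real_of_int b) \<le> real q * ln (real_of_int a)"
    using assms by (simp add: ln_realpow)
  also have "\<dots> \<longleftrightarrow> real p * ln (real_of_int b) / ln (real_of_int a) \<le> real q"
    using assms by (simp add: divide_le_eq)
  also have "\<dots> \<longleftrightarrow> \<lceil>real p * ln (real_of_int b) / ln (real_of_int a)\<rceil> \<le> int q"
    by (simp add: ceiling_le_iff)
  finally show ?thesis .
qed

lemma ceiling_eq_Least:
  fixes a b :: int and p q :: nat
  assumes "1 < a" "a < b"
  shows "int q = \<lceil>real p * ln (real_of_int b) / ln (real_of_int a)\<rceil> \<longleftrightarrow>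
           q = (LEAST q. 1 \<le> (of_int a ^ q / of_int b ^ p :: rat))"
proof -
  define c where "c = \<lceil>real p * ln (real_of_int b) / ln (real_of_int a)\<rceil>"
  have "0 \<le> real p * ln (real_of_int b) / ln (real_of_int a)"
    using assms by simp
  then have c0: "0 \<le> c"
    unfolding c_def by linarith
  have "(LEAST q. 1 \<le> (of_int a ^ q / of_int b ^ p :: rat)) = (LEAST q. c \<le> int q)"
    using one_le_power_quotient_iff[OF assms] by (simp add: c_def)
  also have "\<dots> = nat c"
    using c0 by (intro Least_equality) auto
  finally show ?thesis
    using c0 unfolding c_def[symmetric] by auto
qed

lemma F_set_bounds:
  assumes "1 < a" "a < b" "x \<in> F_set a b"
  shows "1 \<le> x" "x < of_int a"
proof -
  obtain p q :: nat where x: "x = of_int a ^ q / of_int b ^ p"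
    and q: "int q = \<lceil>real p * ln (real_of_int b) / ln (real_of_int a)\<rceil>"
    using assms(3) by (auto simp: F_set_def)
  show "1 \<le> x"
    using one_le_power_quotient_iff[OF assms(1,2), of q p] q x by simp
  show "x < of_int a"
  proof (cases q)
    case 0
    then have "x \<le> 1"
      using x assms(1,2) by (simp add: divide_le_eq one_le_power)
    then show ?thesis
      using assms(1) by (smt (verit) le_less_trans of_int_1_less_iff)
  next
    case (Suc r)
    then have "\<not> 1 \<le> (of_int a ^ r / of_int b ^ p :: rat)"
      using one_le_power_quotient_iff[OF assms(1,2), of r p] q by simp
    then have "of_int a * (of_int a ^ r / of_int b ^ p :: rat) < of_int a * 1"
      using assms(1) by (intro mult_strict_left_mono) auto
    then show ?thesis
      using x Suc by simp
  qed
qed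

end

theory Submission
  imports Defs
begin

text \<open>
  Taking logarithms to base \<open>a\<close> turns the fractions \<open>a\<^sup>q / b\<^sup>p\<close> into the fractional parts of
  \<open>- p * log a b\<close>. Coprimality makes \<open>log a b\<close> irrational, so these fractional parts are dense
  in \<open>[0, 1]\<close> by Kronecker's approximation theorem, and \<open>t \<mapsto> a powr t\<close> maps \<open>[0, 1]\<close> continuously
  onto \<open>[1, a]\<close>.
\<close>

text \<open>If the logarithm were \<open>m / n\<close>, the numbers \<open>b ^ n\<close> and
  \<open>a ^ m\<close> would be equal as well as coprime, so \<open>a ^ m\<close> would be a unit
  although it exceeds 1.\<close>

lemma log_notin_Rats:
  fixes a b :: int
  assumes "coprime a b" "1 < a" "1 < b"
  shows "log (real_of_int a) (real_of_int b) \<notin> \<rat>"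
proof
  assume "log (real_of_int a) (real_of_int b) \<in> \<rat>"
  moreover have pos: "0 < log (real_of_int a) (real_of_int b)"
    using assms by simp
  ultimately obtain m n :: nat
    where n: "n \<noteq> 0" and eq: "log (real_of_int a) (real_of_int b) = real m / real n"
    by (metis Rats_abs_nat_div_natE abs_of_pos)
  \<comment> \<open>This excludes \<open>a ^ 0 = 1\<close>, which is a unit.\<close>
  have m: "m \<noteq> 0"
    using pos eq by (metis div_0 less_irrefl of_nat_0)
  have "real n * ln (real_of_int b) = real m * ln (real_of_int a)"
    using eq n assms by (simp add: log_def field_simps)
  then have "ln (real_of_int (b ^ n)) = ln (real_of_int (a ^ m))"
    using assms by (simp add: ln_realpow)
  then have "b ^ n = a ^ m"
    using assms by (subst (asm) ln_inj_iff) (auto simp del: of_int_power)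
  moreover have "coprime (a ^ m) (b ^ n)"
    using assms(1) by simp
  ultimately have "is_unit (a ^ m)"
    by simp
  then show False
    using one_less_power[of a m] m assms(2) by simp
qed

text \<open>With \<open>L = log a b\<close> the fraction is \<open>a powr (q - p * L)\<close>, and
  rounding \<open>p * L\<close> up to \<open>q\<close> leaves a gap in
  \<open>[0, 1)\<close>.\<close>

lemma real_F_set_eq:
  fixes a b :: int
  assumes "1 < a" "a < b"
  shows "real_of_rat ` F_set a b =
           (\<lambda>t. real_of_int a powr t) `
             range (\<lambda>p. frac (real p * - log (real_of_int a) (real_of_int b)))"
proof -
  define L where "L = log (real_of_int a) (real_of_int b)"
  have L: "0 < L"
    using assms by (simp add: L_def)
  have ln_div: "real p * ln (real_of_int b) / ln (real_of_int a) = real p * L" for p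
    by (simp add: L_def log_def)
  have key: "real_of_rat (of_int a ^ q / of_int b ^ p) = real_of_int a powr frac (real p * - L)"
    if "int q = \<lceil>real p * L\<rceil>" for p q :: nat
  proof -
    \<comment> \<open>The ceiling of \<open>x\<close> is minus the floor of \<open>-x\<close>, hence
      the sign in front of \<open>L\<close>.\<close>
    have "frac (real p * - L) = real q - L * real p"
      using arg_cong[OF that, of real_of_int] by (simp add: frac_def ceiling_def mult.commute)
    then show ?thesis
      using assms
      by (simp add: powr_diff powr_realpow L_def of_rat_divide of_rat_power flip: powr_powr)
  qed
  \<comment> \<open>Since the ceiling is nonnegative, every \<open>p\<close> has a natural exponent
    \<open>q\<close>.\<close>
  have "int (nat \<lceil>real p * L\<rceil>) = \<lceil>real p * L\<rceil>" for p
    using L by (simp add: less_le_trans[of "-1" 0])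
  with key have "real_of_int a powr frac (real p * - L) \<in> real_of_rat ` F_set a b" for p
    unfolding F_set_def ln_div by (metis (mono_tags, lifting) imageI mem_Collect_eq)
  moreover have "real_of_rat ` F_set a b \<subseteq> range (\<lambda>p. real_of_int a powr frac (real p * - L))"
    unfolding F_set_def ln_div using key by blast
  ultimately show ?thesis
    unfolding L_def by (auto simp: image_image)
qed

theorem theorem7p1:
  fixes a b :: int
  assumes "coprime a b" and "1 < a" and "a < b"
  shows "top_of_set {1..real_of_int a} closure_of (real_of_rat ` F_set a b) = {1..real_of_int a}"
proof -
  let ?L = "log (real_of_int a) (real_of_int b)"
  let ?fr = "range (\<lambda>p. frac (real p * - ?L))"
  let ?f = "\<lambda>t. real_of_int a powr t"
  have "- ?L \<notin> \<rat>"
    using log_notin_Rats[of a b] assms by simp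
  then have clo: "closure ?fr = {0..1}"
    by (rule Kronecker_approx_1)
  have "{1..real_of_int a} \<subseteq> ?f ` {0..1}"
  proof
    fix x assume "x \<in> {1..real_of_int a}"
    then show "x \<in> ?f ` {0..1}"
      using assms by (intro image_eqI[of _ _ "log (real_of_int a) x"]) auto
  qed
  \<comment> \<open>Passing to the closure also captures the endpoint \<open>a = ?f 1\<close>: 1 is
    not a fractional part, only a limit of such.\<close>
  also have "\<dots> \<subseteq> closure (?f ` ?fr)"
    unfolding clo[symmetric]
  proof (rule image_closure_subset)
    show "continuous_on (closure ?fr) ?f"
      using assms by (intro continuous_intros) auto
  qed (simp_all only: closed_closure closure_subset)
  also have "?f ` ?fr = real_of_rat ` F_set a b"
    using real_F_set_eq[OF assms(2,3)] by simp
  finally have dense: "{1..real_of_int a} \<subseteq> closure (real_of_rat ` F_set a b)" .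
  \<comment> \<open>The closure in the subspace only sees the part of the set inside the segment, so
    the whole set is shown to lie there.\<close>
  have "x \<in> {1..real_of_int a}" if x: "x \<in> real_of_rat ` F_set a b" for x
  proof -
    obtain r where r: "r \<in> F_set a b" "x = real_of_rat r"
      using x by blast
    have "real_of_rat 1 \<le> real_of_rat r" "real_of_rat r < real_of_rat (of_int a)"
      using F_set_bounds[OF assms(2,3) r(1)] by (simp_all only: of_rat_less_eq of_rat_less)
    then show ?thesis
      using r by simp
  qed
  then have "{1..real_of_int a} \<inter> real_of_rat ` F_set a b = real_of_rat ` F_set a b"
    by blast
  with dense show ?thesis
    by (auto simp: closure_of_subtopology)
qed

end
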